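(* For $n\ge1$, a topological space $X$ is hereditarily $(n+1)$-irresolvable iff $X\models_C\mathbb{C}_n$.
   Context: Modal formulas are built from variables by $\top,\neg,\wedge,\Box$, with $\Diamond=\neg\Box\neg$, $\Box^*\varphi=\varphi\wedge\Box\varphi$. C-semantics: a topological model on a space $X$ assigns a subset $V(p)\subseteq X$ to each variable; truth sets $\mathcal{M}_C(\varphi)$ are defined inductively with Boolean connectives as set operations, $\mathcal{M}_C(\Box\varphi)$ the interior of $\mathcal{M}_C(\varphi)$ (so $\Diamond$ is closure). $X\models_C\varphi$ means $\mathcal{M}_C(\varphi)=X$ for every model on $X$; for a scheme, for every instance. Define $\mathbb{P}_0(\varphi_0)=\Diamond\varphi_0$, $\mathbb{P}_n(\varphi_0,\dots,\varphi_n)=\Diamond(\varphi_1\wedge\mathbb{P}_{n-1}(\varphi_0,\varphi_2,\dots,\varphi_n))$ for $n>0$; $\mathbb{D}_n=\bigwedge_{i<j\le n}\neg(\varphi_i\wedge\varphi_j)$; $\mathbb{C}_n$ is the scheme $\Box^*\mathbb{D}_n\to(\Diamond\varphi_0\to\Diamond(\varphi_0\wedge\neg\mathbb{P}_n))$. For $k\ge2$, a space is $k$-resolvable if it has $k$ pairwise disjoint dense subsets, $k$-irresolvable otherwise, and hereditarily $k$-irresolvable if every non-empty subspace is $k$-irresolvable. *)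

theory Defs
  imports "HOL-Analysis.Abstract_Topology" "HOL-Library.Disjoint_Sets"
begin

text \<open>There are countably infinitely many propositional variables, indexed by \<^typ>\<open>nat\<close>.\<close>

datatype fm = Var nat | Top | Neg fm | And fm fm | Box fm

definition Imp :: "fm \<Rightarrow> fm \<Rightarrow> fm" where
  "Imp \<phi> \<psi> = Neg (And \<phi> (Neg \<psi>))"

definition Dia :: "fm \<Rightarrow> fm" where
  "Dia \<phi> = Neg (Box (Neg \<phi>))"

definition BoxStar :: "fm \<Rightarrow> fm" where
  "BoxStar \<phi> = And \<phi> (Box \<phi>)"

definition Conj :: "fm list \<Rightarrow> fm" where
  "Conj \<phi>s = foldr And \<phi>s Top"

text \<open>
  The argument tuple \<open>(\<phi>\<^sub>0, \<dots>, \<phi>\<^sub>n)\<close> is given by the values of \<open>\<phi> :: nat \<Rightarrow> fm\<close> at \<open>0, \<dots>, n\<close>;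
  no other value of \<open>\<phi>\<close> is used.  In the recursive call of \<open>PP\<close> the tuple is
  \<open>(\<phi>\<^sub>0, \<phi>\<^sub>2, \<dots>, \<phi>\<^sub>n)\<close>, that is, \<open>\<phi>\<^sub>1\<close> is dropped and the later entries move down by one.
\<close>

fun PP :: "nat \<Rightarrow> (nat \<Rightarrow> fm) \<Rightarrow> fm" where
  "PP 0 \<phi> = Dia (\<phi> 0)"
| "PP (Suc n) \<phi> = Dia (And (\<phi> 1) (PP n (\<lambda>i. if i = 0 then \<phi> 0 else \<phi> (Suc i))))"

definition DD :: "nat \<Rightarrow> (nat \<Rightarrow> fm) \<Rightarrow> fm" where
  "DD n \<phi> = Conj [Neg (And (\<phi> i) (\<phi> j)). j \<leftarrow> [0..<Suc n], i \<leftarrow> [0..<j]]"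

definition CC :: "nat \<Rightarrow> (nat \<Rightarrow> fm) \<Rightarrow> fm" where
  "CC n \<phi> = Imp (BoxStar (DD n \<phi>)) (Imp (Dia (\<phi> 0)) (Dia (And (\<phi> 0) (Neg (PP n \<phi>)))))"

definition CC_scheme :: "nat \<Rightarrow> fm set" where
  "CC_scheme n = range (CC n)"

primrec truth_set :: "'a topology \<Rightarrow> (nat \<Rightarrow> 'a set) \<Rightarrow> fm \<Rightarrow> 'a set" where
  "truth_set X V (Var p) = V p"
| "truth_set X V Top = topspace X"
| "truth_set X V (Neg \<phi>) = topspace X - truth_set X V \<phi>"
| "truth_set X V (And \<phi> \<psi>) = truth_set X V \<phi> \<inter> truth_set X V \<psi>"
| "truth_set X V (Box \<phi>) = X interior_of (truth_set X V \<phi>)"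

definition C_valid :: "'a topology \<Rightarrow> fm \<Rightarrow> bool" where
  "C_valid X \<phi> \<longleftrightarrow> (\<forall>V. (\<forall>p. V p \<subseteq> topspace X) \<longrightarrow> truth_set X V \<phi> = topspace X)"

definition C_valid_scheme :: "'a topology \<Rightarrow> fm set \<Rightarrow> bool" where
  "C_valid_scheme X \<Phi> \<longleftrightarrow> (\<forall>\<phi>\<in>\<Phi>. C_valid X \<phi>)"

text \<open>
  The \<open>k\<close> dense sets are given as an indexed family.  In a non-empty space dense sets are
  non-empty, so the members of a pairwise disjoint family of them are automatically distinct;
  the empty space counts as resolvable but is excluded in the hereditary notion.
\<close>

definition resolvable :: "nat \<Rightarrow> 'a topology \<Rightarrow> bool" where
  "resolvable k X \<longleftrightarrow>
     (\<exists>D :: nat \<Rightarrow> 'a set.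
        (\<forall>i<k. D i \<subseteq> topspace X \<and> X closure_of (D i) = topspace X) \<and>
        disjoint_family_on D {..<k})"

definition hereditarily_irresolvable :: "nat \<Rightarrow> 'a topology \<Rightarrow> bool" where
  "hereditarily_irresolvable k X \<longleftrightarrow>
     (\<forall>S. S \<subseteq> topspace X \<and> S \<noteq> {} \<longrightarrow> \<not> resolvable k (subtopology X S))"

end

theory Submission
  imports Defs
begin

text \<open>
  Write \<open>A\<^sub>i\<close> for the truth set of \<open>\<phi>\<^sub>i\<close>.  Then \<open>\<P>\<^sub>n\<close> denotes
  \<open>cl (A\<^sub>1 \<inter> cl (A\<^sub>2 \<inter> \<dots> cl (A\<^sub>n \<inter> cl A\<^sub>0)))\<close>.  If \<open>\<C>\<^sub>n\<close> fails at a point, that point has an open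
  neighbourhood \<open>U\<close> on which the \<open>A\<^sub>i\<close> are disjoint and \<open>A\<^sub>0 \<inter> U\<close> is a non-empty subset of \<open>\<P>\<^sub>n\<close>.
  With \<open>Q\<^sub>0 = A\<^sub>0 \<inter> U\<close> and \<open>Q\<^sub>i\<close> the part inside \<open>U\<close> of the set under the \<open>i\<close>-th closure of \<open>\<P>\<^sub>n\<close>,
  one has \<open>Q\<^sub>0 \<subseteq> cl Q\<^sub>1\<close>, \<open>Q\<^sub>1 \<subseteq> cl Q\<^sub>2\<close>, \<dots>, \<open>Q\<^sub>n \<subseteq> cl Q\<^sub>0\<close>, so every \<open>Q\<^sub>i\<close> is dense in the union of
  all of them.  Conversely, interpreting the variables by disjoint dense subsets of a non-empty
  subspace \<open>S\<close> makes \<open>\<P>\<^sub>n\<close> contain \<open>S\<close>, which refutes \<open>\<C>\<^sub>n\<close>.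
\<close>

lemma truth_set_subset_topspace:
  assumes "\<forall>p. V p \<subseteq> topspace X"
  shows "truth_set X V \<phi> \<subseteq> topspace X"
  using assms
proof (induction \<phi>)
  case (Box \<phi>)
  then show ?case by (simp add: interior_of_subset_topspace)
qed auto

lemma truth_set_Dia: "truth_set X V (Dia \<phi>) = X closure_of truth_set X V \<phi>"
  by (simp add: Dia_def closure_of_interior_of)

lemma truth_set_Conj:
  "truth_set X V (Conj \<phi>s) = {x \<in> topspace X. \<forall>\<phi>\<in>set \<phi>s. x \<in> truth_set X V \<phi>}"
proof (induction \<phi>s)
  case Nil
  then show ?case by (simp add: Conj_def)
next
  case (Cons \<phi> \<phi>s)
  then show ?case by (auto simp: Conj_def)
qed

lemma truth_set_DD:
  "truth_set X V (DD n \<phi>) =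
     {x \<in> topspace X. \<forall>j\<le>n. \<forall>i<j. x \<notin> truth_set X V (\<phi> i) \<inter> truth_set X V (\<phi> j)}"
  by (auto simp: DD_def truth_set_Conj less_Suc_eq_le simp del: upt_Suc)

lemma truth_set_BoxStar: "truth_set X V (BoxStar \<phi>) = X interior_of truth_set X V \<phi>"
  by (simp add: BoxStar_def Int_absorb1 interior_of_subset)

lemma truth_set_Imp_eq_topspace:
  assumes "\<forall>p. V p \<subseteq> topspace X"
  shows "truth_set X V (Imp \<phi> (Imp \<psi> \<chi>)) = topspace X \<longleftrightarrow>
    truth_set X V \<phi> \<inter> truth_set X V \<psi> \<subseteq> truth_set X V \<chi>"
  using truth_set_subset_topspace[OF assms, of \<phi>] truth_set_subset_topspace[OF assms, of \<psi>]
  by (simp add: Imp_def) blast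

lemma truth_set_CC_eq_topspace:
  assumes "\<forall>p. V p \<subseteq> topspace X"
  shows "truth_set X V (CC n \<phi>) = topspace X \<longleftrightarrow>
    X interior_of truth_set X V (DD n \<phi>) \<inter> X closure_of truth_set X V (\<phi> 0) \<subseteq>
    X closure_of (truth_set X V (\<phi> 0) - truth_set X V (PP n \<phi>))"
proof -
  have "truth_set X V (And (\<phi> 0) (Neg (PP n \<phi>))) = truth_set X V (\<phi> 0) - truth_set X V (PP n \<phi>)"
    using truth_set_subset_topspace[OF assms, of "\<phi> 0"] by auto
  then show ?thesis
    unfolding CC_def truth_set_Imp_eq_topspace[OF assms] truth_set_Dia truth_set_BoxStar
    by presburger
qed

text \<open>By induction from the innermost closure outwards: since \<open>\<phi> 1\<close> holds
  only inside \<open>S\<close>, and \<open>S\<close> lies in the inner \<open>PP\<close>, the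
  conjunction under the outer closure is just \<open>\<phi> 1\<close>, which is dense in
  \<open>S\<close>.\<close>

lemma subset_truth_set_PP:
  assumes "\<And>i. i \<le> n \<Longrightarrow> truth_set X V (\<phi> i) \<subseteq> S"
    and "\<And>i. i \<le> n \<Longrightarrow> S \<subseteq> X closure_of truth_set X V (\<phi> i)"
  shows "S \<subseteq> truth_set X V (PP n \<phi>)"
  using assms
proof (induction n arbitrary: \<phi>)
  case 0
  then show ?case by (simp add: truth_set_Dia)
next
  case (Suc n)
  let ?\<phi> = "\<lambda>i. if i = 0 then \<phi> 0 else \<phi> (Suc i)"
  have "S \<subseteq> truth_set X V (PP n ?\<phi>)"
    by (rule Suc.IH) (use Suc.prems in auto)
  then have "truth_set X V (\<phi> 1) \<inter> truth_set X V (PP n ?\<phi>) = truth_set X V (\<phi> 1)"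
    using Suc.prems(1)[of 1] by auto
  then show ?case
    using Suc.prems(2)[of 1] by (simp add: truth_set_Dia)
qed

text \<open>Openness of \<open>U\<close> lets the restriction to \<open>U\<close> pass under each
  closure. Once \<open>Q 0\<close> is known to lie in \<open>PP n \<phi>\<close>, the two closure
  inclusions combine into a cycle through \<open>Q 0\<close>.\<close>

lemma truth_set_PP_chain:
  assumes "openin X U"
  shows "\<exists>Q. Q 0 = U \<inter> truth_set X V (\<phi> 0) \<and>
    (\<forall>i\<le>n. Q i \<subseteq> U \<inter> truth_set X V (\<phi> i) \<and> Q i \<subseteq> X closure_of Q 0 \<and>
       U \<inter> truth_set X V (PP n \<phi>) \<subseteq> X closure_of Q i)"
proof (induction n arbitrary: \<phi>)
  case 0
  have "U \<inter> truth_set X V (\<phi> 0) \<subseteq> topspace X"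
    using openin_subset[OF assms] by blast
  then have "U \<inter> truth_set X V (\<phi> 0) \<subseteq> X closure_of (U \<inter> truth_set X V (\<phi> 0))"
    by (rule closure_of_subset)
  then show ?case
    using openin_Int_closure_of_subset[OF assms]
    by (intro exI[of _ "\<lambda>_. U \<inter> truth_set X V (\<phi> 0)"]) (simp add: truth_set_Dia)
next
  case (Suc n)
  let ?\<phi> = "\<lambda>i. if i = 0 then \<phi> 0 else \<phi> (Suc i)"
  obtain Q where Q0: "Q 0 = U \<inter> truth_set X V (\<phi> 0)"
    and Q: "\<And>i. i \<le> n \<Longrightarrow> Q i \<subseteq> U \<inter> truth_set X V (?\<phi> i)"
      "\<And>i. i \<le> n \<Longrightarrow> Q i \<subseteq> X closure_of Q 0"
      "\<And>i. i \<le> n \<Longrightarrow> U \<inter> truth_set X V (PP n ?\<phi>) \<subseteq> X closure_of Q i"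
    using Suc.IH[of ?\<phi>] by auto
  \<comment> \<open>\<open>R\<close> is the part in \<open>U\<close> of the set under the outermost
    closure. It enters at index 1; the chain of the shortened tuple keeps its index 0 and moves its
    other indices up by one.\<close>
  define R where "R = U \<inter> (truth_set X V (\<phi> 1) \<inter> truth_set X V (PP n ?\<phi>))"
  define Q' where "Q' i = (if i = 0 then Q 0 else if i = 1 then R else Q (i - 1))" for i
  have R_closure: "R \<subseteq> X closure_of Q i" if "i \<le> n" for i
    using Q(3)[OF that] by (auto simp: R_def)
  have PP_closure_R: "U \<inter> truth_set X V (PP (Suc n) \<phi>) \<subseteq> X closure_of R"
    using openin_Int_closure_of_subset[OF assms] by (simp add: truth_set_Dia R_def)
  have PP_closure_Q: "U \<inter> truth_set X V (PP (Suc n) \<phi>) \<subseteq> X closure_of Q i" if "i \<le> n" for i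
  proof -
    have "X closure_of R \<subseteq> X closure_of Q i"
      using R_closure[OF that] by (simp add: closure_of_minimal)
    with PP_closure_R show ?thesis by (rule subset_trans)
  qed
  have "Q' i \<subseteq> U \<inter> truth_set X V (\<phi> i) \<and> Q' i \<subseteq> X closure_of Q' 0 \<and>
      U \<inter> truth_set X V (PP (Suc n) \<phi>) \<subseteq> X closure_of Q' i" if "i \<le> Suc n" for i
  proof -
    consider "i = 0" | "i = 1" | j where "i = Suc j" "j \<noteq> 0" "j \<le> n"
    proof (cases i)
      case (Suc j)
      then show ?thesis using \<open>i \<le> Suc n\<close> that(2,3) by (cases "j = 0") simp_all
    qed (use that in simp)
    then show ?thesis
    proof cases
      case 1
      then show ?thesis
        using Q(1,2)[of 0] PP_closure_Q[of 0] by (simp add: Q'_def)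
    next
      case 2
      then show ?thesis
        using R_closure[of 0] PP_closure_R by (auto simp: Q'_def R_def)
    next
      case 3
      then show ?thesis
        using Q(1,2)[of j] PP_closure_Q[of j] by (simp add: Q'_def)
    qed
  qed
  moreover have "Q' 0 = U \<inter> truth_set X V (\<phi> 0)"
    by (simp add: Q'_def Q0)
  ultimately show ?case by blast
qed

lemma resolvable_subtopology_UN:
  assumes "\<And>i. i < k \<Longrightarrow> Q i \<subseteq> topspace X"
    and "\<And>i j. i < k \<Longrightarrow> j < k \<Longrightarrow> Q i \<subseteq> X closure_of Q j"
    and "disjoint_family_on Q {..<k}"
  shows "resolvable k (subtopology X (\<Union>i<k. Q i))"
  unfolding resolvable_def
proof (intro exI conjI allI impI)
  let ?S = "\<Union>i<k. Q i"
  fix i assume "i < k"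
  then have "?S \<inter> Q i = Q i" by blast
  moreover have "?S \<subseteq> topspace X" using assms(1) by blast
  moreover have "?S \<subseteq> X closure_of Q i" using assms(2) \<open>i < k\<close> by blast
  ultimately show "Q i \<subseteq> topspace (subtopology X ?S)"
    and "subtopology X ?S closure_of Q i = topspace (subtopology X ?S)"
    by (auto simp: closure_of_subtopology)
qed (fact assms)

lemma hereditarily_irresolvable_imp_C_valid_CC:
  assumes "hereditarily_irresolvable (Suc n) X"
  shows "C_valid X (CC n \<phi>)"
  unfolding C_valid_def
proof (intro allI impI)
  fix V :: "nat \<Rightarrow> 'a set"
  assume V: "\<forall>p. V p \<subseteq> topspace X"
  let ?A = "\<lambda>i. truth_set X V (\<phi> i)"
  let ?P = "truth_set X V (PP n \<phi>)"
  let ?D = "truth_set X V (DD n \<phi>)"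
  show "truth_set X V (CC n \<phi>) = topspace X"
    unfolding truth_set_CC_eq_topspace[OF V]
  proof
    fix x assume x: "x \<in> X interior_of ?D \<inter> X closure_of ?A 0"
    show "x \<in> X closure_of (?A 0 - ?P)"
    proof (rule ccontr)
      assume not_x: "x \<notin> X closure_of (?A 0 - ?P)"
      \<comment> \<open>An open neighbourhood of \<open>x\<close> on which the \<open>?A i\<close>
        with \<open>i \<le> n\<close> are pairwise disjoint and \<open>?A 0\<close> is contained in
        \<open>?P\<close>.\<close>
      define U where "U = X interior_of ?D - X closure_of (?A 0 - ?P)"
      have U: "openin X U" by (simp add: U_def openin_diff)
      obtain Q where Q0: "Q 0 = U \<inter> ?A 0"
        and Q: "\<And>i. i \<le> n \<Longrightarrow> Q i \<subseteq> U \<inter> ?A i" "\<And>i. i \<le> n \<Longrightarrow> Q i \<subseteq> X closure_of Q 0"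
          "\<And>i. i \<le> n \<Longrightarrow> U \<inter> ?P \<subseteq> X closure_of Q i"
        using truth_set_PP_chain[OF U, of V \<phi> n] by auto
      have "?A 0 - ?P \<subseteq> X closure_of (?A 0 - ?P)"
        using truth_set_subset_topspace[OF V, of "\<phi> 0"] by (intro closure_of_subset) blast
      then have Q0_sub: "Q 0 \<subseteq> U \<inter> ?P"
        using Q0 by (auto simp: U_def)
      \<comment> \<open>The cycle closes here: \<open>Q i\<close> lies in the closure of
        \<open>Q 0\<close>, and \<open>Q 0\<close>, being inside \<open>U \<inter> ?P\<close>, lies
        in the closure of \<open>Q j\<close>.\<close>
      have dense: "Q i \<subseteq> X closure_of Q j" if "i \<le> n" "j \<le> n" for i j
      proof -
        have "X closure_of Q 0 \<subseteq> X closure_of Q j"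
          using Q0_sub Q(3)[OF \<open>j \<le> n\<close>] by (intro closure_of_minimal) auto
        then show ?thesis using Q(2)[OF \<open>i \<le> n\<close>] by blast
      qed
      have disj: "Q i \<inter> Q j = {}" if "i < j" "j \<le> n" for i j
      proof -
        have "U \<subseteq> ?D" using interior_of_subset[of X ?D] by (auto simp: U_def)
        then have "U \<inter> ?A i \<inter> ?A j = {}" using that unfolding truth_set_DD by blast
        then show ?thesis using Q(1)[of i] Q(1)[of j] that by fastforce
      qed
      have "disjoint_family_on Q {..<Suc n}"
        unfolding disjoint_family_on_def
      proof (intro ballI impI)
        fix i j assume "i \<in> {..<Suc n}" "j \<in> {..<Suc n}" "i \<noteq> j"
        then show "Q i \<inter> Q j = {}"
          using disj[of i j] disj[of j i] by (cases "i < j") auto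
      qed
      moreover have Q_top: "Q i \<subseteq> topspace X" if "i < Suc n" for i
        using Q(1)[of i] openin_subset[OF U] that by auto
      ultimately have "resolvable (Suc n) (subtopology X (\<Union>i<Suc n. Q i))"
        using dense by (intro resolvable_subtopology_UN) auto
      moreover have "(\<Union>i<Suc n. Q i) \<noteq> {}"
      proof -
        have "x \<in> U" using x not_x by (simp add: U_def)
        \<comment> \<open>An open set containing a point of the closure of \<open>?A 0\<close> meets
          \<open>?A 0\<close>.\<close>
        then have "Q 0 \<noteq> {}"
          using x openin_Int_closure_of_eq_empty[OF U, of "?A 0"] by (auto simp: Q0)
        then show ?thesis by blast
      qed
      moreover have "(\<Union>i<Suc n. Q i) \<subseteq> topspace X" using Q_top by blast
      ultimately show False
        using assms unfolding hereditarily_irresolvable_def by blast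
    qed
  qed
qed

text \<open>The instance with distinct variables is enough, because a valuation can send them to any
  given dense sets.\<close>

lemma C_valid_CC_Var_imp_hereditarily_irresolvable:
  assumes "C_valid X (CC n Var)"
  shows "hereditarily_irresolvable (Suc n) X"
  unfolding hereditarily_irresolvable_def
proof (intro allI impI notI)
  fix S assume S: "S \<subseteq> topspace X \<and> S \<noteq> {}" and "resolvable (Suc n) (subtopology X S)"
  then obtain D where D_top: "\<forall>i<Suc n. D i \<subseteq> topspace (subtopology X S) \<and>
      subtopology X S closure_of D i = topspace (subtopology X S)"
    and disj: "disjoint_family_on D {..<Suc n}"
    unfolding resolvable_def by blast
  have D: "D i \<subseteq> S" "subtopology X S closure_of D i = S" if "i \<le> n" for i
    using D_top S that by (auto simp: less_Suc_eq_le topspace_subtopology_subset)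
  \<comment> \<open>Nothing is known about \<open>D i\<close> for \<open>i > n\<close>; the default
    \<open>{}\<close> keeps every value inside the space.\<close>
  define V where "V i = (if i \<le> n then D i else {})" for i
  have V: "\<forall>p. V p \<subseteq> topspace X"
  proof
    fix p show "V p \<subseteq> topspace X"
      using D(1)[of p] S by (cases "p \<le> n") (auto simp: V_def)
  qed
  have dense: "S \<subseteq> X closure_of V i" if "i \<le> n" for i
    using closure_of_subtopology_subset[of X S "D i"] that unfolding D(2)[OF that] by (simp add: V_def)
  have "S \<subseteq> truth_set X V (PP n Var)"
    using dense D(1) by (intro subset_truth_set_PP) (auto simp: V_def)
  \<comment> \<open>The conclusion of the instance becomes the closure of the empty set, whereas its
    premises hold on the closure of \<open>V 0\<close>, which contains \<open>S\<close>.\<close>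
  then have PP: "truth_set X V (Var 0) - truth_set X V (PP n Var) = {}"
    using D(1)[of 0] by (auto simp: V_def)
  have "V i \<inter> V j = {}" if "i < j" "j \<le> n" for i j
    using disjoint_family_onD[OF disj, of i j] that by (simp add: V_def)
  then have DD: "truth_set X V (DD n Var) = topspace X"
    unfolding truth_set_DD truth_set.simps by blast
  have "truth_set X V (CC n Var) = topspace X"
    using assms V by (simp add: C_valid_def)
  then have "topspace X \<inter> X closure_of V 0 \<subseteq> {}"
    unfolding truth_set_CC_eq_topspace[OF V] PP DD by simp
  then show False using S dense[of 0] by blast
qed

theorem theorem8p1:
  fixes X :: "'a topology" and n :: nat
  assumes "n \<ge> 1"
  shows "hereditarily_irresolvable (n + 1) X \<longleftrightarrow> C_valid_scheme X (CC_scheme n)"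
  using hereditarily_irresolvable_imp_C_valid_CC[of n X]
    C_valid_CC_Var_imp_hereditarily_irresolvable[of X n]
  by (auto simp: C_valid_scheme_def CC_scheme_def)

end
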